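(* Let $d \geq 2$ and let $C \subset \mathbb{R}^d$ be a smooth $d$-dimensional combinatorial cube. Then $C$ has two facets which are parallel to each other.
   Context: A lattice polytope is the convex hull of finitely many points of $\mathbb{Z}^d$. A $d$-dimensional polytope is simple if each vertex lies in exactly $d$ edges. The primitive edge directions at a vertex are the smallest lattice vectors pointing along its incident edges. A $d$-dimensional lattice polytope in $\mathbb{R}^d$ is smooth if it is simple and at every vertex the primitive edge directions form a basis of $\mathbb{Z}^d$. A $d$-dimensional combinatorial cube is a polytope whose face poset is isomorphic to that of $[0,1]^d$. Two faces $F,G$ are parallel if $\mathrm{lin}(F)=\mathrm{lin}(G)$, where $\mathrm{lin}(F)$ is the linear subspace parallel to the affine hull of $F$. *)

theory Defs
  imports "HOL-Analysis.Analysis"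
begin

definition lattice_point :: "real^'n \<Rightarrow> bool" where
  "lattice_point x \<longleftrightarrow> (\<forall>i. x $ i \<in> \<int>)"

definition lattice_polytope :: "(real^'n) set \<Rightarrow> bool" where
  "lattice_polytope P \<longleftrightarrow>
     (\<exists>S. finite S \<and> (\<forall>x\<in>S. lattice_point x) \<and> P = convex hull S)"

definition poly_vertex :: "real^'n \<Rightarrow> (real^'n) set \<Rightarrow> bool" where
  "poly_vertex v P \<longleftrightarrow> {v} face_of P"

definition poly_edge :: "(real^'n) set \<Rightarrow> (real^'n) set \<Rightarrow> bool" where
  "poly_edge E P \<longleftrightarrow> E face_of P \<and> aff_dim E = 1"

definition simple_polytope :: "(real^'n) set \<Rightarrow> bool" where
  "simple_polytope P \<longleftrightarrow> polytope P \<and> aff_dim P = int CARD('n) \<and>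
     (\<forall>v. poly_vertex v P \<longrightarrow> card {E. poly_edge E P \<and> v \<in> E} = CARD('n))"

definition primitive_edge_direction ::
    "real^'n \<Rightarrow> (real^'n) set \<Rightarrow> real^'n \<Rightarrow> bool" where
  "primitive_edge_direction v E u \<longleftrightarrow>
     u \<noteq> 0 \<and> lattice_point u \<and> (\<exists>t>0. v + t *\<^sub>R u \<in> E) \<and>
     (\<forall>s. 0 < s \<and> s < 1 \<longrightarrow> \<not> lattice_point (s *\<^sub>R u))"

definition lattice_basis :: "(real^'n) set \<Rightarrow> bool" where
  "lattice_basis B \<longleftrightarrow> finite B \<and> card B = CARD('n) \<and> independent B \<and>
     {x. lattice_point x} = {\<Sum>b\<in>B. c b *\<^sub>R b | c. \<forall>b\<in>B. c b \<in> \<int>}"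

definition smooth_polytope :: "(real^'n) set \<Rightarrow> bool" where
  "smooth_polytope P \<longleftrightarrow> lattice_polytope P \<and> simple_polytope P \<and>
     (\<forall>v. poly_vertex v P \<longrightarrow>
        lattice_basis {u. \<exists>E. poly_edge E P \<and> v \<in> E \<and> primitive_edge_direction v E u})"

text \<open>Combinatorial cube: face poset (all faces, including the empty face and P)
  isomorphic to that of [0,1]^d.\<close>
definition combinatorial_cube :: "(real^'n) set \<Rightarrow> bool" where
  "combinatorial_cube P \<longleftrightarrow> polytope P \<and>
     (\<exists>f. bij_betw f {F. F face_of P} {F. F face_of cbox (0::real^'n) (vec 1)} \<and>
          (\<forall>F G. F face_of P \<longrightarrow> G face_of P \<longrightarrow> (F \<subseteq> G \<longleftrightarrow> f F \<subseteq> f G)))"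

definition lin_space :: "(real^'n) set \<Rightarrow> (real^'n) set" where
  "lin_space F = span {x - y | x y. x \<in> F \<and> y \<in> F}"

definition parallel_faces :: "(real^'n) set \<Rightarrow> (real^'n) set \<Rightarrow> bool" where
  "parallel_faces F G \<longleftrightarrow> lin_space F = lin_space G"

end

theory Submission
  imports Defs
begin

text \<open>
  Index the vertices of the cube by subsets \<open>S\<close> of the \<open>d\<close> coordinates, and let \<open>u S j\<close> be the
  primitive direction of the edge from \<open>v S\<close> to \<open>v (flip j S)\<close>. Smoothness gives each facet
  \<open>F i e\<close> a normal \<open>n i e\<close> such that at every vertex the \<open>n i (i \<in> S)\<close> are dual to the \<open>u S j\<close>;
  together with \<open>u (flip j S) j = - u S j\<close> this forces \<open>n j (j \<notin> S) \<bullet> u S j = -1\<close>.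
  Let \<open>b i j = n i True \<bullet> u {} j\<close>. If no two opposite facets were parallel, every row of \<open>b\<close>
  would have a nonzero off-diagonal entry, so the digraph of these entries would contain a
  chordless cycle \<open>T\<close>. For \<open>k \<in> T\<close> write \<open>u (T - {k}) k\<close> in the basis \<open>u {} j\<close>: its coefficients
  vanish outside \<open>T\<close>, the coefficient at \<open>k\<close> is 1, the one at the successor of \<open>k\<close> is 0, and
  zeros propagate along the cycle until they reach \<open>k\<close>, a contradiction.
\<close>

section \<open>Vertices of the unit cube as subsets, and the faces of the unit cube\<close>

definition flip :: "'a \<Rightarrow> 'a set \<Rightarrow> 'a set" where
  "flip j S = {i. (i \<in> S) \<noteq> (i = j)}"

lemma mem_flip [simp]: "i \<in> flip j S \<longleftrightarrow> (i \<in> S) \<noteq> (i = j)"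
  by (simp add: flip_def)

lemma flip_flip [simp]: "flip j (flip j S) = S"
  by auto

lemma flip_neq: "flip j S \<noteq> S" "flip j S = flip k S \<Longrightarrow> j = k"
  by (metis mem_flip)+

definition cube_vertex :: "'n set \<Rightarrow> real^'n" where
  "cube_vertex S = (\<chi> i. if i \<in> S then 1 else 0)"

definition cube_face :: "'n set \<Rightarrow> 'n set \<Rightarrow> (real^'n) set" where
  "cube_face I S = {x \<in> cbox 0 (vec 1). \<forall>i\<in>I. x $ i = cube_vertex S $ i}"

lemma mem_unit_cube: "x \<in> cbox (0::real^'n) 1 \<longleftrightarrow> (\<forall>i. 0 \<le> x $ i \<and> x $ i \<le> 1)"
  by (simp add: mem_box_cart)

lemma cube_vertex_mem: "cube_vertex S \<in> cube_face I S' \<longleftrightarrow> (\<forall>i\<in>I. i \<in> S \<longleftrightarrow> i \<in> S')"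
  by (simp add: cube_face_def cube_vertex_def mem_unit_cube) blast

lemma cube_face_UNIV: "cube_face UNIV S = {cube_vertex S}"
  by (auto simp: cube_face_def cube_vertex_def mem_unit_cube vec_eq_iff)

lemma inj_cube_vertex: "inj (cube_vertex :: 'n::finite set \<Rightarrow> _)"
proof (rule injI)
  fix S S' :: "'n set"
  assume "cube_vertex S = cube_vertex S'"
  then have "(if i \<in> S then 1 else 0::real) = (if i \<in> S' then 1 else 0)" for i
    by (simp add: cube_vertex_def vec_eq_iff)
  then show "S = S'"
    by (metis (full_types) subsetI subset_antisym zero_neq_one)
qed

text \<open>0 and 1 are the extreme points of the unit interval. The case of 1 reduces to that of 0
  by reflecting both numbers; there a sum of two nonnegative terms vanishes.\<close>

lemma convex_combination_extreme:
  fixes a b t :: real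
  assumes "0 < t" "t < 1" "0 \<le> a" "a \<le> 1" "0 \<le> b" "b \<le> 1"
    and "(1 - t) * a + t * b = e" "e = 0 \<or> e = 1"
  shows "a = e \<and> b = e"
proof -
  have *: "p = 0 \<and> q = 0" if "0 \<le> p" "0 \<le> q" "(1 - t) * p + t * q = 0" for p q
    using that assms(1,2)
    by (smt (verit) mult_nonneg_nonneg mult_pos_pos)
  show ?thesis
    using assms(8)
  proof
    assume "e = 0"
    then show ?thesis
      using *[of a b] assms by auto
  next
    assume "e = 1"
    then have "(1 - t) * (1 - a) + t * (1 - b) = 0"
      using assms(7) by (simp add: algebra_simps)
    then show ?thesis
      using *[of "1 - a" "1 - b"] assms \<open>e = 1\<close> by auto
  qed
qed

lemma cube_face_face_of: "cube_face I S face_of cbox 0 (vec 1)"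
proof -
  have sub: "cube_face I S \<subseteq> cbox 0 (vec 1)"
    by (auto simp: cube_face_def)
  \<comment> \<open>Written as a box cut by coordinate hyperplanes, the set is visibly
    convex.\<close>
  have "cube_face I S = cbox 0 (vec 1) \<inter> (\<Inter>i\<in>I. {x. axis i 1 \<bullet> x = cube_vertex S $ i})"
    by (auto simp: cube_face_def inner_axis')
  then have conv: "convex (cube_face I S)"
    by (simp only:) (intro convex_Int convex_INT convex_box convex_hyperplane)
  have "a \<in> cube_face I S \<and> b \<in> cube_face I S"
    if a: "a \<in> cbox 0 (vec 1)" and b: "b \<in> cbox 0 (vec 1)"
      and x: "x \<in> cube_face I S" "x \<in> open_segment a b" for a b x
  proof -
    obtain t where t: "0 < t" "t < 1" and xt: "x = (1 - t) *\<^sub>R a + t *\<^sub>R b"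
      using x(2) by (auto simp: in_segment)
    have "a $ i = cube_vertex S $ i \<and> b $ i = cube_vertex S $ i" if "i \<in> I" for i
    proof (rule convex_combination_extreme[OF t])
      show "0 \<le> a $ i" "a $ i \<le> 1" "0 \<le> b $ i" "b $ i \<le> 1"
        using a b by (simp_all add: mem_unit_cube)
      show "cube_vertex S $ i = 0 \<or> cube_vertex S $ i = 1"
        by (simp add: cube_vertex_def)
      have "x $ i = cube_vertex S $ i"
        using x(1) that by (simp add: cube_face_def)
      then show "(1 - t) * a $ i + t * b $ i = cube_vertex S $ i"
        by (simp add: xt)
    qed
    then show ?thesis
      using a b by (auto simp: cube_face_def)
  qed
  then show ?thesis
    unfolding face_of_def using sub conv by blast
qed

text \<open>A point of the edge whose coordinate \<open>j\<close> is strictly between 0 and 1 lies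
  in the open segment between the two ends and so is not extreme.\<close>

lemma cube_edge_extreme_point:
  assumes y: "y \<in> cube_face (- {j}) S" and ext: "{y} face_of cbox 0 (vec 1)"
  shows "y = cube_vertex S \<or> y = cube_vertex (flip j S)"
proof (rule ccontr)
  assume "\<not> ?thesis"
  then have ne: "y \<noteq> cube_vertex S" "y \<noteq> cube_vertex (flip j S)" by auto
  \<comment> \<open>These are the two ends ordered by coordinate \<open>j\<close>, so that
    \<open>y $ j\<close> is the convex weight whether or not \<open>j\<close> lies in
    \<open>S\<close>.\<close>
  let ?a = "cube_vertex (S - {j})" and ?b = "cube_vertex (insert j S)"
  have yi: "y $ i = cube_vertex S $ i" if "i \<noteq> j" for i
    using y that by (auto simp: cube_face_def)
  have yj: "0 \<le> y $ j" "y $ j \<le> 1"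
    using y by (auto simp: cube_face_def mem_unit_cube)
  have eq: "y = (1 - y $ j) *\<^sub>R ?a + (y $ j) *\<^sub>R ?b"
    unfolding vec_eq_iff
  proof
    fix i show "y $ i = ((1 - y $ j) *\<^sub>R ?a + y $ j *\<^sub>R ?b) $ i"
      using yi[of i] by (cases "i = j") (auto simp: cube_vertex_def)
  qed
  have "y = ?a" if "y $ j = 0"
    using eq that by (metis diff_zero scaleR_one scaleR_zero_left add_0_right)
  moreover have "y = ?b" if "y $ j = 1"
    using eq that by (metis diff_self scaleR_one scaleR_zero_left add_0)
  moreover have "?a = cube_vertex S \<or> ?a = cube_vertex (flip j S)"
    "?b = cube_vertex S \<or> ?b = cube_vertex (flip j S)"
  proof -
    have "S - {j} = S \<or> S - {j} = flip j S" "insert j S = S \<or> insert j S = flip j S"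
      by auto
    then show "?a = cube_vertex S \<or> ?a = cube_vertex (flip j S)"
    "?b = cube_vertex S \<or> ?b = cube_vertex (flip j S)" by auto
  qed
  ultimately have "y $ j \<noteq> 0" "y $ j \<noteq> 1"
    using ne by metis+
  then have "0 < y $ j" "y $ j < 1"
    using yj by auto
  moreover have "?a \<noteq> ?b"
    using inj_cube_vertex by (auto dest!: injD)
  ultimately have "y \<in> open_segment ?a ?b"
    using eq by (auto simp: in_segment)
  moreover have "?a \<in> cbox 0 (vec 1)" "?b \<in> cbox 0 (vec 1)"
    by (auto simp: mem_unit_cube cube_vertex_def)
  ultimately have "?a = y \<and> ?b = y"
    using ext unfolding face_of_def by blast
  then show False
    using \<open>?a \<noteq> ?b\<close> by auto
qed

section \<open>Transfer of vertices, edges and facets along the face isomorphism\<close>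

lemma polytope_face_has_extreme_point:
  fixes P :: "'a::euclidean_space set"
  assumes "polytope P" "F face_of P" "F \<noteq> {}"
  obtains w where "w \<in> F" "{w} face_of P"
proof -
  have "compact F" "convex F"
    using assms face_of_polytope_polytope polytope_imp_compact polytope_imp_convex by blast+
  then obtain w where "w extreme_point_of F"
    using assms(3) extreme_point_exists_convex by blast
  then show thesis
    using that assms(2) by (metis face_of_singleton face_of_trans extreme_point_of_def)
qed

text \<open>
  A face isomorphism is not assumed to preserve dimensions; the edges are recovered as the faces
  whose only extreme points are the two endpoints.
\<close>

lemma combinatorial_cube_frame:
  fixes C :: "(real^'n) set"
  assumes "combinatorial_cube C"
  obtains v :: "'n set \<Rightarrow> real^'n" and F :: "'n \<Rightarrow> bool \<Rightarrow> (real^'n) set"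
  where "inj v" "\<And>S. {v S} face_of C" "\<And>i e. F i e face_of C"
    "\<And>S i e. v S \<in> F i e \<longleftrightarrow> (i \<in> S \<longleftrightarrow> e)"
    "\<And>S j. closed_segment (v S) (v (flip j S)) face_of C"
proof -
  define Q where "Q = cbox (0::real^'n) (vec 1)"
  have cube_face_Q: "cube_face I S face_of Q" for I S
    using cube_face_face_of by (simp only: Q_def)
  have P: "polytope C" and PQ: "polytope Q"
    using assms polytope_interval unfolding combinatorial_cube_def Q_def by blast+
  obtain f where bij: "bij_betw f {F. F face_of C} {F. F face_of Q}"
    and mono: "\<And>F G. F face_of C \<Longrightarrow> G face_of C \<Longrightarrow> F \<subseteq> G \<longleftrightarrow> f F \<subseteq> f G"
    using assms unfolding combinatorial_cube_def Q_def by blast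
  have fQ: "f F face_of Q" if "F face_of C" for F
    using bij_betw_apply[OF bij, of F] that by simp
  have surj: "\<exists>F. F face_of C \<and> f F = G" if "G face_of Q" for G
  proof -
    have "G \<in> f ` {F. F face_of C}"
      using that by (simp add: bij_betw_imp_surj_on[OF bij])
    then show ?thesis by auto
  qed
  have f_eq: "f F = f G \<longleftrightarrow> F = G" if "F face_of C" "G face_of C" for F G
    using mono[OF that] mono[OF that(2,1)] by auto
  have f_empty: "f F = {} \<longleftrightarrow> F = {}" if "F face_of C" for F
  proof -
    obtain G where "G face_of C" "f G = {}"
      using surj[of "{}"] by auto
    then have "f {} = {}"
      using mono[of "{}" G] by auto
    then show ?thesis
      using f_eq[of F "{}"] that by auto
  qed
  have "\<forall>I S. \<exists>F. F face_of C \<and> f F = cube_face I S"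
    using surj[OF cube_face_Q] by blast
  then obtain g where g: "\<And>I S. g I S face_of C" "\<And>I S. f (g I S) = cube_face I S"
    by metis
  have g_mono: "g I S \<subseteq> g J S' \<longleftrightarrow> cube_face I S \<subseteq> cube_face J S'" for I J S S'
    using mono g by metis
  \<comment> \<open>The face contains a vertex \<open>w\<close> of \<open>C\<close>; the image of
    \<open>{w}\<close> is a nonempty part of a singleton, hence all of it, and injectivity of
    \<open>f\<close> on faces concludes.\<close>
  have "\<exists>w. g UNIV S = {w}" for S
  proof -
    have "g UNIV S \<noteq> {}"
      using f_empty[OF g(1)[of UNIV S]] g(2)[of UNIV S] by (simp add: cube_face_UNIV)
    then obtain w where w: "w \<in> g UNIV S" "{w} face_of C"
      using polytope_face_has_extreme_point[OF P g(1)] by metis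
    have "f {w} \<subseteq> {cube_vertex S}"
      using mono[OF w(2) g(1)[of UNIV S]] w(1) by (simp add: cube_face_UNIV g(2))
    moreover have "f {w} \<noteq> {}"
      using f_empty[OF w(2)] by simp
    ultimately have "f {w} = f (g UNIV S)"
      using g(2) cube_face_UNIV by (metis subset_singletonD)
    then show ?thesis
      using f_eq w(2) g(1) by metis
  qed
  then obtain v where v: "\<And>S. g UNIV S = {v S}"
    by metis
  have v_mem: "v S \<in> g I S' \<longleftrightarrow> cube_vertex S \<in> cube_face I S'" for S I S'
    using g_mono[of UNIV S I S'] by (simp add: v cube_face_UNIV)
  show thesis
  \<comment> \<open>Only the membership of \<open>i\<close> in the second argument matters;
    \<open>UNIV\<close> and \<open>{}\<close> encode the values 1 and 0 of coordinate
    \<open>i\<close>.\<close>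
  proof (rule that[of v "\<lambda>i e. g {i} (if e then UNIV else {})"])
    show "inj v"
    proof (rule injI)
      fix S S' assume "v S = v S'"
      then have "cube_face UNIV S = cube_face UNIV S'"
        using g(2)[of UNIV S] g(2)[of UNIV S'] by (simp add: v)
      then show "S = S'"
        using injD[OF inj_cube_vertex] by (simp add: cube_face_UNIV)
    qed
    show "{v S} face_of C" for S
      using g(1) v by metis
    show "g {i} (if e then UNIV else {}) face_of C" for i e
      by (rule g)
    show "v S \<in> g {i} (if e then UNIV else {}) \<longleftrightarrow> (i \<in> S \<longleftrightarrow> e)" for S i e
      by (auto simp: v_mem cube_vertex_mem)
    show "closed_segment (v S) (v (flip j S)) face_of C" for S j
    proof -
      let ?E = "g (- {j}) S"
      have polyE: "polytope ?E"
        using P g(1) face_of_polytope_polytope by blast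
      have ends: "v S \<in> ?E" "v (flip j S) \<in> ?E"
        by (auto simp: v_mem cube_vertex_mem)
      have "w = v S \<or> w = v (flip j S)" if "w extreme_point_of ?E" for w
      proof -
        have w: "{w} face_of C" "w \<in> ?E"
          using that g(1) by (metis face_of_singleton face_of_trans, simp add: extreme_point_of_def)
        \<comment> \<open>The preimage of a vertex \<open>y\<close> inside \<open>f {w}\<close> is a
          nonempty face contained in \<open>{w}\<close>, so \<open>f\<close> sends the vertex
          \<open>w\<close> to a vertex.\<close>
        obtain y where y: "y \<in> f {w}" "{y} face_of Q"
          using polytope_face_has_extreme_point[OF PQ fQ[OF w(1)]] f_empty[OF w(1)] by blast
        obtain G where G: "G face_of C" "f G = {y}"
          using surj[OF y(2)] by blast
        have "G \<subseteq> {w}" "G \<noteq> {}"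
          using mono[OF G(1) w(1)] f_empty[OF G(1)] G y by auto
        then have fw: "f {w} = {y}"
          using G by (metis subset_singletonD)
        have "y \<in> cube_face (- {j}) S"
          using mono[OF w(1) g(1)] w(2) g(2) fw by auto
        then have "f {w} = f (g UNIV S) \<or> f {w} = f (g UNIV (flip j S))"
          using cube_edge_extreme_point[OF _ y(2)[unfolded Q_def]] fw g(2) cube_face_UNIV by metis
        then show ?thesis
          using f_eq[OF w(1) g(1)[of UNIV S]] f_eq[OF w(1) g(1)[of UNIV "flip j S"]] by (simp add: v)
      qed
      then have "{w. w extreme_point_of ?E} \<subseteq> {v S, v (flip j S)}"
        by auto
      moreover have "?E = convex hull {w. w extreme_point_of ?E}"
        using Krein_Milman_Minkowski polyE polytope_imp_compact polytope_imp_convex by blast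
      ultimately have "?E \<subseteq> closed_segment (v S) (v (flip j S))"
        by (metis hull_mono segment_convex_hull)
      moreover have "closed_segment (v S) (v (flip j S)) \<subseteq> ?E"
        using ends polyE closed_segment_subset polytope_imp_convex by blast
      ultimately show ?thesis
        using g(1) by (metis subset_antisym)
    qed
  qed
qed

section \<open>Primitive edge directions at the vertices of the cube\<close>

lemma primitive_edge_direction_scaled:
  assumes "primitive_edge_direction v (closed_segment v w) u"
  obtains p where "p > 0" "u = p *\<^sub>R (w - v)"
proof -
  obtain t where t: "t > 0" "v + t *\<^sub>R u \<in> closed_segment v w" and "u \<noteq> 0"
    using assms by (auto simp: primitive_edge_direction_def)
  then obtain s where s: "0 \<le> s" "v + t *\<^sub>R u = (1 - s) *\<^sub>R v + s *\<^sub>R w"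
    by (auto simp: in_segment)
  then have tu: "t *\<^sub>R u = s *\<^sub>R (w - v)"
    by (simp add: algebra_simps)
  have "s \<noteq> 0"
    using tu t \<open>u \<noteq> 0\<close> by auto
  moreover have "u = (s / t) *\<^sub>R (w - v)"
    using arg_cong[OF tu, of "\<lambda>x. (1 / t) *\<^sub>R x"] t by simp
  ultimately show thesis
    using that[of "s / t"] s t by simp
qed

text \<open>Both are positive multiples of the same vector; if they differed, the shorter would be a
  lattice point violating primitivity of the longer.\<close>

lemma primitive_edge_direction_unique:
  assumes "primitive_edge_direction v (closed_segment v w) u"
    and "primitive_edge_direction v (closed_segment v w) u'"
  shows "u = u'"
proof -
  have *: False
    if "0 < p" "p < q" "primitive_edge_direction v (closed_segment v w) (p *\<^sub>R (w - v))"
      "primitive_edge_direction v (closed_segment v w) (q *\<^sub>R (w - v))" for p q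
  proof -
    have "p *\<^sub>R (w - v) = (p / q) *\<^sub>R q *\<^sub>R (w - v)" "0 < p / q" "p / q < 1"
      using that(1,2) by simp_all
    then show False
      using that(3,4) unfolding primitive_edge_direction_def by metis
  qed
  obtain p q where "p > 0" "q > 0" "u = p *\<^sub>R (w - v)" "u' = q *\<^sub>R (w - v)"
    using assms primitive_edge_direction_scaled by metis
  then show ?thesis
    using *[of p q] *[of q p] assms by (cases p q rule: linorder_cases) auto
qed

lemma primitive_edge_direction_reverse:
  assumes "primitive_edge_direction v (closed_segment v w) u"
  shows "primitive_edge_direction w (closed_segment w v) (- u)"
proof -
  obtain p where p: "p > 0" "u = p *\<^sub>R (w - v)"
    using primitive_edge_direction_scaled[OF assms] .
  have "w + (1 / p) *\<^sub>R (- u) = v"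
    using p(1) by (simp add: p(2))
  then have "\<exists>t>0. w + t *\<^sub>R (- u) \<in> closed_segment w v"
    using p(1) by (metis ends_in_segment(2) zero_less_divide_1_iff)
  then show ?thesis
    using assms by (auto simp: primitive_edge_direction_def lattice_point_def)
qed

text \<open>Two counts give the indexing. Simplicity allows exactly d edges at \<open>v S\<close>,
  so the d known segments are all of them. The d basis vectors choose distinct edges by uniqueness
  of primitive directions, so every edge is chosen.\<close>

lemma smooth_cube_edge_directions:
  fixes C :: "(real^'n) set" and v :: "'n set \<Rightarrow> real^'n"
  assumes "smooth_polytope C" "inj v" and vert: "\<And>S. {v S} face_of C"
    and edge: "\<And>S j. closed_segment (v S) (v (flip j S)) face_of C"
  obtains u :: "'n set \<Rightarrow> 'n \<Rightarrow> real^'n"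
  where "\<And>S. lattice_basis (range (u S))"
    "\<And>S j. primitive_edge_direction (v S) (closed_segment (v S) (v (flip j S))) (u S j)"
proof -
  have "\<exists>f. lattice_basis (range f) \<and>
      (\<forall>j. primitive_edge_direction (v S) (closed_segment (v S) (v (flip j S))) (f j))" for S
  proof -
    define E where "E = (\<lambda>j. closed_segment (v S) (v (flip j S)))"
    have v_ne: "v S \<noteq> v (flip j S)" for j
      using injD[OF assms(2)] flip_neq(1) by metis
    have "poly_edge (E j) C" for j
      using edge v_ne[of j] by (simp add: E_def poly_edge_def segment_convex_hull aff_dim_convex_hull aff_dim_2)
    then have sub: "range E \<subseteq> {E. poly_edge E C \<and> v S \<in> E}"
      by (auto simp: E_def)
    have "inj E"
    proof (rule injI)
      fix j k assume "E j = E k"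
      then have "v (flip j S) = v (flip k S)"
        unfolding E_def by (metis closed_segment_eq doubleton_eq_iff)
      then show "j = k"
        using injD[OF assms(2)] flip_neq(2) by metis
    qed
    then have "card (range E) = CARD('n)"
      by (simp add: card_image)
    moreover have "card {E. poly_edge E C \<and> v S \<in> E} = CARD('n)"
      using assms(1) vert[of S] by (auto simp: smooth_polytope_def simple_polytope_def poly_vertex_def)
    \<comment> \<open>An infinite set would have cardinality 0, but the cardinality is
      positive.\<close>
    moreover have "finite {E. poly_edge E C \<and> v S \<in> E}"
      by (rule card_ge_0_finite) (simp add: calculation)
    ultimately have edges: "{E. poly_edge E C \<and> v S \<in> E} = range E"
      using card_subset_eq[OF _ sub] by simp
    define B where "B = {u. \<exists>j. primitive_edge_direction (v S) (E j) u}"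
    have edge_iff: "poly_edge G C \<and> v S \<in> G \<longleftrightarrow> (\<exists>j. G = E j)" for G
      using edges[THEN eqset_imp_iff, of G] by (simp add: image_iff)
    have "{u. \<exists>G. poly_edge G C \<and> v S \<in> G \<and> primitive_edge_direction (v S) G u} = B"
      unfolding B_def by (intro Collect_cong) (metis edge_iff)
    moreover have "lattice_basis {u. \<exists>G. poly_edge G C \<and> v S \<in> G \<and> primitive_edge_direction (v S) G u}"
      using assms(1) vert[of S] unfolding smooth_polytope_def poly_vertex_def by blast
    ultimately have B: "lattice_basis B"
      by simp
    have "\<forall>u\<in>B. \<exists>j. primitive_edge_direction (v S) (E j) u"
      by (simp add: B_def)
    then obtain h where h: "\<And>u. u \<in> B \<Longrightarrow> primitive_edge_direction (v S) (E (h u)) u"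
      by (rule bchoice[THEN exE]) blast
    have inj_h: "inj_on h B"
    proof (rule inj_onI)
      fix x y assume xy: "x \<in> B" "y \<in> B" "h x = h y"
      show "x = y"
        using primitive_edge_direction_unique[OF h[OF xy(1), unfolded E_def]] h[OF xy(2)] xy(3)
        by (simp add: E_def)
    qed
    have "card (h ` B) = CARD('n)"
      using B by (simp add: card_image[OF inj_h] lattice_basis_def)
    then have "h ` B = UNIV"
      using card_subset_eq[of UNIV "h ` B"] by simp
    then have "bij_betw h B UNIV"
      using inj_h by (simp add: bij_betw_def)
    then have bij: "bij_betw (inv_into B h) UNIV B"
      by (rule bij_betw_inv_into)
    have "primitive_edge_direction (v S) (E j) (inv_into B h j)" for j
      using h[of "inv_into B h j"] \<open>h ` B = UNIV\<close> by (simp add: inv_into_into f_inv_into_f)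
    then show ?thesis
      using B bij_betw_imp_surj_on[OF bij] unfolding E_def
      by (intro exI[of _ "inv_into B h"]) simp
  qed
  then have "\<exists>u. \<forall>S. lattice_basis (range (u S)) \<and>
      (\<forall>j. primitive_edge_direction (v S) (closed_segment (v S) (v (flip j S))) (u S j))"
    by (intro choice allI)
  then show thesis
    using that by blast
qed

section \<open>Lattice bases and normalised facet normals\<close>

lemma lattice_basis_span:
  fixes B :: "(real^'n) set"
  assumes "lattice_basis B"
  shows "span B = UNIV"
  using assms card_eq_dim[of B UNIV] by (auto simp: lattice_basis_def)

text \<open>In the integer expansion of \<open>z\<close> every term except that of
  \<open>u i\<close> is killed by \<open>a\<close>; \<open>m\<close> is the coefficient that
  remains.\<close>

lemma lattice_basis_integer_multiple:
  fixes a :: "real^'n"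
  assumes "lattice_basis (range u)" "lattice_point z" and "\<And>j. j \<noteq> i \<Longrightarrow> a \<bullet> u j = 0"
  obtains m where "m \<in> \<int>" "a \<bullet> z = m * (a \<bullet> u i)"
proof -
  obtain c where z: "z = (\<Sum>b\<in>range u. c b *\<^sub>R b)" and c: "\<forall>b\<in>range u. c b \<in> \<int>"
    using assms(1,2) unfolding lattice_basis_def by blast
  have fin: "finite (range u)"
    using assms(1) by (simp add: lattice_basis_def)
  have "a \<bullet> z = (\<Sum>b\<in>range u. c b * (a \<bullet> b))"
    by (simp add: z inner_sum_right)
  also have "\<dots> = (\<Sum>b\<in>{u i}. c b * (a \<bullet> b))"
  proof (rule sum.mono_neutral_right[OF fin])
    have "a \<bullet> b = 0" if b: "b \<in> range u - {u i}" for b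
    proof -
      obtain j where "b = u j" "j \<noteq> i"
        using b by blast
      then show ?thesis
        by (simp add: assms(3))
    qed
    then show "\<forall>b\<in>range u - {u i}. c b * (a \<bullet> b) = 0"
      by simp
  qed simp
  finally have "a \<bullet> z = c (u i) * (a \<bullet> u i)"
    by simp
  then show thesis
    using that c by auto
qed

text \<open>A functional exposing \<open>F\<close> vanishes on the edges within \<open>F\<close> and
  is negative on the edge leaving it. Once that negative value is known to be the same at all
  vertices of \<open>F\<close>, a single rescaling normalises it to 1 everywhere.\<close>

lemma facet_normal:
  fixes C :: "(real^'n) set" and v :: "'n set \<Rightarrow> real^'n"
  assumes "polytope C" and F: "F face_of C"
    and v_C: "\<And>S. v S \<in> C" and v_F: "\<And>S. v S \<in> F \<longleftrightarrow> (i \<in> S \<longleftrightarrow> e)"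
    and basis: "\<And>S. lattice_basis (range (u S))"
    and prim: "\<And>S j. primitive_edge_direction (v S) (closed_segment (v S) (v (flip j S))) (u S j)"
  obtains n where "\<And>x y. x \<in> F \<Longrightarrow> y \<in> F \<Longrightarrow> n \<bullet> (x - y) = 0"
    "\<And>S j. (i \<in> S \<longleftrightarrow> e) \<Longrightarrow> n \<bullet> u S j = (if j = i then 1 else 0)"
proof -
  have "F exposed_face_of C"
    using assms(1) F exposed_face_of_polyhedron polytope_imp_polyhedron by blast
  then obtain a b where ab: "C \<subseteq> {x. a \<bullet> x \<le> b}" "F = C \<inter> {x. a \<bullet> x = b}"
    by (auto simp: exposed_face_of_def)
  have tangent: "a \<bullet> u S j = 0" if "(i \<in> S \<longleftrightarrow> e)" "j \<noteq> i" for S j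
  proof -
    obtain p where p: "p > 0" "u S j = p *\<^sub>R (v (flip j S) - v S)"
      using primitive_edge_direction_scaled[OF prim] .
    have "v S \<in> F" "v (flip j S) \<in> F"
      using that by (auto simp: v_F)
    then show ?thesis
      by (simp add: p(2) ab(2) inner_diff_right)
  qed
  have inward: "a \<bullet> u S i < 0" if "(i \<in> S \<longleftrightarrow> e)" for S
  proof -
    obtain p where p: "p > 0" "u S i = p *\<^sub>R (v (flip i S) - v S)"
      using primitive_edge_direction_scaled[OF prim] .
    have "v S \<in> F" "v (flip i S) \<notin> F"
      using that by (auto simp: v_F)
    then have "a \<bullet> v S = b" "a \<bullet> v (flip i S) < b"
      using ab v_C[of "flip i S"] by force+
    then show ?thesis
      using p(1) by (simp add: p(2) inner_diff_right mult_pos_neg)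
  qed
  \<comment> \<open>\<open>a\<close> maps the lattice onto the integer multiples of \<open>a \<bullet> u S i\<close>, so this number does not depend
    on the vertex \<open>S\<close> of the facet.\<close>
  have le: "a \<bullet> u S' i \<le> a \<bullet> u S i" if S: "(i \<in> S \<longleftrightarrow> e)" and S': "(i \<in> S' \<longleftrightarrow> e)" for S S'
  proof -
    have "lattice_point (u S' i)"
      using prim by (auto simp: primitive_edge_direction_def)
    then obtain m where m: "m \<in> \<int>" "a \<bullet> u S' i = m * (a \<bullet> u S i)"
      using lattice_basis_integer_multiple[OF basis[of S], of "u S' i" i a] tangent[OF S] by blast
    \<comment> \<open>Both values are negative, so the integer \<open>m\<close> is at least 1.
      Exchanging \<open>S\<close> and \<open>S'\<close> later turns the inequality into
      equality.\<close>
    have "m > 0"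
      using inward[OF S] inward[OF S'] m(2) by (simp add: mult_less_0_iff)
    then have "m \<ge> 1"
      using m(1) by (auto elim!: Ints_cases)
    then show ?thesis
      using inward[OF S] m(2) by simp
  qed
  define S0 where "S0 = (if e then UNIV else {} :: 'n set)"
  define h where "h = a \<bullet> u S0 i"
  have S0: "i \<in> S0 \<longleftrightarrow> e" by (simp add: S0_def)
  have "h < 0" using inward[OF S0] by (simp add: h_def)
  have h: "a \<bullet> u S i = h" if "(i \<in> S \<longleftrightarrow> e)" for S
    using le[OF that S0] le[OF S0 that] by (simp add: h_def)
  show thesis
  \<comment> \<open>Since \<open>h\<close> is negative, this turns the outer normal into an inner
    one.\<close>
  proof (rule that[of "(1 / h) *\<^sub>R a"])
    show "((1 / h) *\<^sub>R a) \<bullet> (x - y) = 0" if "x \<in> F" "y \<in> F" for x y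
      using that ab(2) by (simp add: inner_diff_right)
    show "((1 / h) *\<^sub>R a) \<bullet> u S j = (if j = i then 1 else 0)" if "(i \<in> S \<longleftrightarrow> e)" for S j
      using h[OF that] tangent[OF that] \<open>h < 0\<close> by simp
  qed
qed

section \<open>Dual bases, chordless cycles and opposite normals\<close>

lemma dual_basis_expansion:
  fixes u n :: "'n::finite \<Rightarrow> 'a::real_inner"
  assumes dual: "\<And>i j. n i \<bullet> u j = (if j = i then 1 else 0)"
    and "span (range u) = UNIV"
  shows "x = (\<Sum>i\<in>UNIV. (n i \<bullet> x) *\<^sub>R u i)"
proof -
  have "x \<in> span (range u)"
    using assms(2) by simp
  then show ?thesis
  proof (induction rule: span_induct_alt)
    case base
    then show ?case by simp
  next
    case (step c y z)
    then obtain j where y: "y = u j" by blast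
    have "(\<Sum>i\<in>UNIV. (n i \<bullet> y) *\<^sub>R u i) = (\<Sum>i\<in>UNIV. if i = j then u j else 0)"
      by (rule sum.cong) (auto simp: y dual)
    then have "(\<Sum>i\<in>UNIV. (n i \<bullet> y) *\<^sub>R u i) = y"
      by (simp add: y)
    moreover have "(\<Sum>i\<in>UNIV. (n i \<bullet> (c *\<^sub>R y + z)) *\<^sub>R u i)
        = c *\<^sub>R (\<Sum>i\<in>UNIV. (n i \<bullet> y) *\<^sub>R u i) + (\<Sum>i\<in>UNIV. (n i \<bullet> z) *\<^sub>R u i)"
      by (simp add: inner_add_right scaleR_left_distrib sum.distrib scaleR_sum_right)
    ultimately show ?case
      using step(2) by simp
  qed
qed

text \<open>
  A minimal nonempty set without sinks is a directed cycle without chords: deleting \<open>t\<close> must create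
  a sink \<open>s t\<close>, whose only successor is then \<open>t\<close>, so \<open>s\<close> is injective and its inverse is the
  successor map \<open>\<sigma>\<close>.
\<close>

lemma minimal_no_sink_set:
  fixes R :: "'n::finite \<Rightarrow> 'n \<Rightarrow> bool"
  assumes "\<And>i. \<exists>j. j \<noteq> i \<and> R i j"
  obtains T \<sigma> where "T \<noteq> {}"
    "\<And>i. i \<in> T \<Longrightarrow> \<sigma> i \<in> T \<and> \<sigma> i \<noteq> i \<and> R i (\<sigma> i)"
    "\<And>i j. i \<in> T \<Longrightarrow> j \<in> T \<Longrightarrow> R i j \<Longrightarrow> j = i \<or> j = \<sigma> i"
    "\<And>Z. Z \<subset> T \<Longrightarrow> Z \<noteq> {} \<Longrightarrow> \<exists>i\<in>Z. \<sigma> i \<notin> Z"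
proof -
  define P where "P = (\<lambda>T. T \<noteq> {} \<and> (\<forall>i\<in>T. \<exists>j\<in>T. j \<noteq> i \<and> R i j))"
  have "P UNIV"
    using assms by (simp add: P_def)
  then obtain T where T: "P T" and least: "\<And>T'. P T' \<Longrightarrow> card T \<le> card T'"
    using ex_has_least_nat[of P UNIV card] by blast
  have minimal: "\<not> P Z" if "Z \<subset> T" for Z
    using least[of Z] psubset_card_mono[OF finite that] by linarith
  \<comment> \<open>By minimality \<open>T - {t}\<close> fails \<open>P\<close>, and it is nonempty
    because \<open>t\<close> has a successor other than itself in \<open>T\<close>.\<close>
  have "\<forall>t\<in>T. \<exists>i. i \<in> T \<and> i \<noteq> t \<and> (\<forall>j\<in>T. j \<noteq> t \<longrightarrow> j \<noteq> i \<longrightarrow> \<not> R i j)"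
  proof
    fix t assume t: "t \<in> T"
    then have "T - {t} \<noteq> {}"
      using T unfolding P_def by blast
    moreover have "\<not> P (T - {t})"
      using t by (intro minimal) blast
    ultimately show "\<exists>i. i \<in> T \<and> i \<noteq> t \<and> (\<forall>j\<in>T. j \<noteq> t \<longrightarrow> j \<noteq> i \<longrightarrow> \<not> R i j)"
      unfolding P_def by blast
  qed
  then obtain s where "\<forall>t\<in>T. s t \<in> T \<and> s t \<noteq> t \<and> (\<forall>j\<in>T. j \<noteq> t \<longrightarrow> j \<noteq> s t \<longrightarrow> \<not> R (s t) j)"
    by (rule bchoice[THEN exE])
  then have s: "s t \<in> T" "s t \<noteq> t" "\<And>j. j \<in> T \<Longrightarrow> j \<noteq> t \<Longrightarrow> j \<noteq> s t \<Longrightarrow> \<not> R (s t) j"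
    if "t \<in> T" for t
    using that by blast+
  have R_s: "R (s t) t" if t: "t \<in> T" for t
  proof -
    obtain j where "j \<in> T" "j \<noteq> s t" "R (s t) j"
      using T s(1)[OF t] unfolding P_def by blast
    then show ?thesis
      using s(3)[OF t] by blast
  qed
  have inj: "inj_on s T"
  proof (rule inj_onI)
    fix t t' assume tt: "t \<in> T" "t' \<in> T" "s t = s t'"
    show "t = t'"
    proof (rule ccontr)
      assume "t \<noteq> t'"
      moreover have "t \<noteq> s t'"
        using s(2)[OF tt(1)] tt(3) by simp
      ultimately show False
        using s(3)[OF tt(2,1)] R_s[OF tt(1)] tt(3) by simp
    qed
  qed
  \<comment> \<open>An injective self-map of a finite set is onto, so the inverse is defined on all
    of \<open>T\<close>.\<close>
  have "s ` T = T"
    using s(1) inj by (intro endo_inj_surj) auto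
  define \<sigma> where "\<sigma> = inv_into T s"
  have \<sigma>: "\<sigma> i \<in> T" "s (\<sigma> i) = i" if "i \<in> T" for i
    using that \<open>s ` T = T\<close> unfolding \<sigma>_def by (auto intro: inv_into_into f_inv_into_f)
  have next_T: "\<sigma> i \<in> T \<and> \<sigma> i \<noteq> i \<and> R i (\<sigma> i)" if i: "i \<in> T" for i
    using s(2)[OF \<sigma>(1)[OF i]] R_s[OF \<sigma>(1)[OF i]] \<sigma>[OF i] by auto
  show thesis
  proof (rule that[of T \<sigma>])
    show "T \<noteq> {}"
      using T by (simp add: P_def)
    show "\<sigma> i \<in> T \<and> \<sigma> i \<noteq> i \<and> R i (\<sigma> i)" if "i \<in> T" for i
      using that by (rule next_T)
    show "j = i \<or> j = \<sigma> i" if "i \<in> T" "j \<in> T" "R i j" for i j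
      using s(3)[OF \<sigma>(1)[OF that(1)] that(2)] \<sigma>(2)[OF that(1)] that(3) by auto
    show "\<exists>i\<in>Z. \<sigma> i \<notin> Z" if Z: "Z \<subset> T" "Z \<noteq> {}" for Z
    \<comment> \<open>A nonempty proper subset closed under \<open>\<sigma>\<close> would have no
      sink, against minimality of \<open>T\<close>.\<close>
    proof (rule ccontr)
      assume "\<not> (\<exists>i\<in>Z. \<sigma> i \<notin> Z)"
      then have "\<forall>i\<in>Z. \<sigma> i \<in> Z \<and> \<sigma> i \<noteq> i \<and> R i (\<sigma> i)"
        using next_T Z(1) by blast
      then have "P Z"
        using Z(2) unfolding P_def by blast
      then show False
        using minimal[OF Z(1)] by simp
    qed
  qed
qed

lemma opposite_normals:
  fixes u :: "'n::finite set \<Rightarrow> 'n \<Rightarrow> 'a::real_inner" and n :: "'n \<Rightarrow> bool \<Rightarrow> 'a"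
  assumes dual: "\<And>S i j. n i (i \<in> S) \<bullet> u S j = (if j = i then 1 else 0)"
    and flip: "\<And>S j. u (flip j S) j = - u S j"
    and span: "span (range (u {})) = UNIV"
  shows "\<exists>i. n i True = - n i False"
proof (rule ccontr)
  assume contra: "\<not> ?thesis"
  define b where "b = (\<lambda>i j. n i True \<bullet> u {} j)"
  define c where "c = (\<lambda>x i. n i False \<bullet> x)"
  \<comment> \<open>Duality is applied at the other end of the edge, where its direction is
    reversed.\<close>
  have opposite: "n j (j \<notin> S) \<bullet> u S j = -1" for S j
    using dual[of j "flip j S" j] by (simp add: flip)
  have b_diag: "b i i = -1" for i
    using opposite[of i "{}"] by (simp add: b_def)
  have "n i False \<bullet> u {} j = (if j = i then 1 else 0)" for i j
    using dual[of i "{}" j] by simp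
  then have expand: "x = (\<Sum>i\<in>UNIV. c x i *\<^sub>R u {} i)" for x
    unfolding c_def by (rule dual_basis_expansion[OF _ span])
  have row: "n m True \<bullet> x = (\<Sum>i\<in>UNIV. c x i * b m i)" for m x
    by (subst expand[of x]) (simp add: inner_sum_right b_def)
  \<comment> \<open>A row with only its diagonal entry -1 would make the two normals of index
    \<open>i\<close> opposite.\<close>
  have "\<exists>j. j \<noteq> i \<and> b i j \<noteq> 0" for i
  proof (rule ccontr)
    assume "\<not> ?thesis"
    then have "n i True \<bullet> x = (\<Sum>j\<in>UNIV. if j = i then - c x i else 0)" for x
      unfolding row by (intro sum.cong) (auto simp: b_diag)
    then have "n i True \<bullet> x = (- n i False) \<bullet> x" for x
      by (simp add: c_def)
    then have "n i True = - n i False"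
      by (rule vector_eq_rdot[THEN iffD1, OF allI])
    then show False
      using contra by blast
  qed
  then show False
  proof (rule minimal_no_sink_set[of "\<lambda>i j. b i j \<noteq> 0"])
    fix T \<sigma>
    assume "T \<noteq> {}"
      and \<sigma>: "\<And>i. i \<in> T \<Longrightarrow> \<sigma> i \<in> T \<and> \<sigma> i \<noteq> i \<and> b i (\<sigma> i) \<noteq> 0"
      and sparse: "\<And>i j. i \<in> T \<Longrightarrow> j \<in> T \<Longrightarrow> b i j \<noteq> 0 \<Longrightarrow> j = i \<or> j = \<sigma> i"
      and minimal: "\<And>Z. Z \<subset> T \<Longrightarrow> Z \<noteq> {} \<Longrightarrow> \<exists>i\<in>Z. \<sigma> i \<notin> Z"
    obtain k where k: "k \<in> T"
      using \<open>T \<noteq> {}\<close> by blast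
    \<comment> \<open>At this vertex the active normals are \<open>n m True\<close> for
      \<open>m\<close> in \<open>T - {k}\<close> and \<open>n m False\<close> for all other
      \<open>m\<close>; duality there gives the next four facts, together with
      \<open>opposite\<close> for \<open>n k True\<close>.\<close>
    define x where "x = u (T - {k}) k"
    have c_out: "c x i = 0" if "i \<notin> T" for i
      using dual[of i "T - {k}" k] that k by (auto simp: c_def x_def)
    have c_k: "c x k = 1"
      using dual[of k "T - {k}" k] by (simp add: c_def x_def)
    have n_k: "n k True \<bullet> x = -1"
      using opposite[of k "T - {k}"] by (simp add: x_def)
    have n_m: "n m True \<bullet> x = 0" if "m \<in> T" "m \<noteq> k" for m
      using dual[of m "T - {k}" k] that by (simp add: x_def)
    \<comment> \<open>Outside \<open>T\<close> the coordinates of \<open>x\<close> vanish; inside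
      \<open>T\<close> chordlessness leaves only the columns \<open>i\<close> and
      \<open>\<sigma> i\<close>.\<close>
    have row_T: "n i True \<bullet> x = - c x i + c x (\<sigma> i) * b i (\<sigma> i)" if i: "i \<in> T" for i
    proof -
      have "c x j * b i j = 0" if "j \<noteq> i" "j \<noteq> \<sigma> i" for j
        using sparse[OF i, of j] c_out[of j] that by auto
      then have "(\<Sum>j\<in>UNIV. c x j * b i j) = (\<Sum>j\<in>{i, \<sigma> i}. c x j * b i j)"
        by (intro sum.mono_neutral_right) auto
      moreover have "i \<noteq> \<sigma> i"
        using \<sigma>[OF i] by auto
      ultimately show ?thesis
        by (simp add: row b_diag)
    qed
    define Z where "Z = {m \<in> T. c x m = 0}"
    \<comment> \<open>Row \<open>k\<close> reads -1 = -1 +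
      \<open>c x (\<sigma> k) * b k (\<sigma> k)\<close> with a nonzero last factor.\<close>
    have "\<sigma> k \<in> Z"
      using row_T[OF k] \<sigma>[OF k] by (simp add: Z_def c_k n_k)
    moreover have "Z \<subset> T"
    proof
      show "Z \<subseteq> T"
        by (auto simp: Z_def)
      have "k \<notin> Z"
        by (simp add: Z_def c_k)
      then show "Z \<noteq> T"
        using k by blast
    qed
    moreover have "\<sigma> m \<in> Z" if "m \<in> Z" for m
    proof -
      have m: "m \<in> T" "c x m = 0" "m \<noteq> k"
        using that c_k by (auto simp: Z_def)
      then show ?thesis
        using row_T[OF m(1)] \<sigma>[OF m(1)] n_m[OF m(1,3)] by (simp add: Z_def)
    qed
    ultimately show False
      using minimal[of Z] by blast
  qed
qed

section \<open>Direction spaces of the facets and the conclusion\<close>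

lemma aff_dim_eq_dim_lin_space:
  assumes "F \<noteq> {}"
  shows "aff_dim F = int (dim (lin_space F))"
proof -
  obtain a where a: "a \<in> F"
    using assms by blast
  have "lin_space F = span ((+) (- a) ` F)"
    unfolding lin_space_def
  proof (rule span_eq[THEN iffD2], intro conjI subsetI)
    fix z assume "z \<in> {x - y |x y. x \<in> F \<and> y \<in> F}"
    then obtain x y where "z = (- a + x) - (- a + y)" "x \<in> F" "y \<in> F"
      by auto
    then show "z \<in> span ((+) (- a) ` F)"
      by (metis imageI span_base span_diff)
  next
    fix z assume "z \<in> (+) (- a) ` F"
    then have "z \<in> {x - y |x y. x \<in> F \<and> y \<in> F}"
      using a by force
    then show "z \<in> span {x - y |x y. x \<in> F \<and> y \<in> F}"
      by (rule span_base)
  qed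
  then show ?thesis
    using aff_dim_eq_dim[OF hull_inc[OF a]] by simp
qed

theorem theorem3p7:
  fixes C :: "(real^'n) set"
  assumes "CARD('n) \<ge> 2"
    and "smooth_polytope C"
    and "combinatorial_cube C"
  shows "\<exists>F G. F facet_of C \<and> G facet_of C \<and> F \<noteq> G \<and> parallel_faces F G"
proof (rule combinatorial_cube_frame[OF assms(3)])
  fix v :: "'n set \<Rightarrow> real^'n" and F :: "'n \<Rightarrow> bool \<Rightarrow> (real^'n) set"
  assume "inj v" and vert: "\<And>S. {v S} face_of C" and F: "\<And>i e. F i e face_of C"
    and v_F: "\<And>S i e. v S \<in> F i e \<longleftrightarrow> (i \<in> S \<longleftrightarrow> e)"
    and edge: "\<And>S j. closed_segment (v S) (v (flip j S)) face_of C"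
  have polytope: "polytope C" and aff_dim_C: "aff_dim C = int CARD('n)"
    using assms(2) by (auto simp: smooth_polytope_def simple_polytope_def)
  have v_C: "v S \<in> C" for S
    using face_of_imp_subset[OF vert] by blast
  show ?thesis
  proof (rule smooth_cube_edge_directions[OF assms(2) \<open>inj v\<close> vert edge])
    fix u :: "'n set \<Rightarrow> 'n \<Rightarrow> real^'n"
    assume basis: "\<And>S. lattice_basis (range (u S))"
      and prim: "\<And>S j. primitive_edge_direction (v S) (closed_segment (v S) (v (flip j S))) (u S j)"
    have "\<forall>i e. \<exists>n. (\<forall>x\<in>F i e. \<forall>y\<in>F i e. n \<bullet> (x - y) = 0) \<and>
        (\<forall>S j. (i \<in> S \<longleftrightarrow> e) \<longrightarrow> n \<bullet> u S j = (if j = i then 1 else 0))"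
    proof (intro allI, rule facet_normal[OF polytope F v_C v_F basis prim])
      fix i e n
      assume "\<And>x y. x \<in> F i e \<Longrightarrow> y \<in> F i e \<Longrightarrow> n \<bullet> (x - y) = 0"
        "\<And>S j. (i \<in> S \<longleftrightarrow> e) \<Longrightarrow> n \<bullet> u S j = (if j = i then 1 else 0)"
      then show "\<exists>n. (\<forall>x\<in>F i e. \<forall>y\<in>F i e. n \<bullet> (x - y) = 0) \<and>
          (\<forall>S j. (i \<in> S \<longleftrightarrow> e) \<longrightarrow> n \<bullet> u S j = (if j = i then 1 else 0))"
        by (intro exI[of _ n]) simp
    qed
    then obtain n where "\<forall>i e. (\<forall>x\<in>F i e. \<forall>y\<in>F i e. n i e \<bullet> (x - y) = 0) \<and>
        (\<forall>S j. (i \<in> S \<longleftrightarrow> e) \<longrightarrow> n i e \<bullet> u S j = (if j = i then 1 else 0))"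
      unfolding choice_iff by (elim exE)
    then have n_F: "\<And>i e x y. x \<in> F i e \<Longrightarrow> y \<in> F i e \<Longrightarrow> n i e \<bullet> (x - y) = 0"
      and dual: "\<And>S i j. n i (i \<in> S) \<bullet> u S j = (if j = i then 1 else 0)"
      by simp_all
    have span: "span (range (u S)) = UNIV" for S
      using lattice_basis_span[OF basis] .
    have lin_F: "lin_space (F i e) = {x. n i e \<bullet> x = 0}" for i e
    proof
      show "lin_space (F i e) \<subseteq> {x. n i e \<bullet> x = 0}"
        unfolding lin_space_def using n_F by (intro span_minimal subspace_hyperplane) auto
      \<comment> \<open>Expand \<open>x\<close> in the edge basis at a vertex of the facet: the
        coefficient of the edge leaving the facet is zero, and all other edges lie in it.\<close>
      show "{x. n i e \<bullet> x = 0} \<subseteq> lin_space (F i e)"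
      proof
        fix x assume x: "x \<in> {x. n i e \<bullet> x = 0}"
        define S where "S = (if e then UNIV else {} :: 'n set)"
        have S: "i \<in> S \<longleftrightarrow> e"
          by (simp add: S_def)
        have "(n j (j \<in> S) \<bullet> x) *\<^sub>R u S j \<in> lin_space (F i e)" for j
        proof (cases "j = i")
          case True
          then show ?thesis
            using x S by (simp add: lin_space_def span_zero)
        next
          case False
          then have "v S \<in> F i e" "v (flip j S) \<in> F i e"
            using S by (auto simp: v_F)
          then have "v (flip j S) - v S \<in> lin_space (F i e)"
            unfolding lin_space_def by (intro span_base) blast
          moreover obtain p where "u S j = p *\<^sub>R (v (flip j S) - v S)"
            using primitive_edge_direction_scaled[OF prim] .
          ultimately show ?thesis
            by (simp add: lin_space_def span_scale)
        qed
        then have "(\<Sum>j\<in>UNIV. (n j (j \<in> S) \<bullet> x) *\<^sub>R u S j) \<in> lin_space (F i e)"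
          unfolding lin_space_def by (intro span_sum)
        then show "x \<in> lin_space (F i e)"
          using dual_basis_expansion[of "\<lambda>j. n j (j \<in> S)" "u S" x, OF dual span] by simp
      qed
    qed
    \<comment> \<open>The face isomorphism carries no dimensions; the codimension comes from
      \<open>lin_F\<close>, which presents the direction space as the hyperplane of a nonzero
      normal.\<close>
    have facet: "F i e facet_of C" for i e
    proof -
      define S where "S = (if e then UNIV else {} :: 'n set)"
      have "i \<in> S \<longleftrightarrow> e"
        by (simp add: S_def)
      then have "v S \<in> F i e" "n i e \<bullet> u S i = 1"
        using dual[of i S i] by (simp_all add: v_F)
      then have "F i e \<noteq> {}" "n i e \<noteq> 0"
        by auto
      then have "aff_dim (F i e) = aff_dim C - 1"
        using zero_less_card_finite[where 'a='n]
        by (simp add: aff_dim_eq_dim_lin_space lin_F dim_hyperplane aff_dim_C of_nat_diff)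
      then show ?thesis
        using F \<open>F i e \<noteq> {}\<close> by (simp add: facet_of_def)
    qed
    have "u (flip j S) j = - u S j" for S j
      using primitive_edge_direction_unique[OF prim[of "flip j S" j], of "- u S j"]
        primitive_edge_direction_reverse[OF prim[of S j]] by simp
    then obtain i where i: "n i True = - n i False"
      using opposite_normals[of n u, OF dual _ span] by blast
    \<comment> \<open>The vertex \<open>v UNIV\<close> lies on the first face only.\<close>
    have "F i True \<noteq> F i False"
      using v_F[of UNIV i True] v_F[of UNIV i False] by auto
    moreover have "parallel_faces (F i True) (F i False)"
      by (simp add: parallel_faces_def lin_F i)
    ultimately show ?thesis
      using facet by blast
  qed
qed

end
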